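(* For $\lambda\in\mathbb{R}$ let $\psi(\cdot,\lambda)$ be the function on $[a,b]$ satisfying $$\psi(x,\lambda)=-2\lambda\int_a^x\int_a^y\psi(z,\lambda)e^{-W(z)}e^{W(y)}\,dz\,dy+\frac{1}{e^{W(a)}}\int_a^xe^{W(z)}dz .$$ Then $\lambda$ is an eigenvalue of $L$ if and only if $\psi(b,\lambda)=0$.
   Context: $a<b$ are fixed and $W:\mathbb{R}\to\mathbb{R}$ is a fixed realization of a two-sided Brownian motion (a continuous function). $L$ is the operator $Lf(x)=\frac{e^{W(x)}}{2}\left(e^{-W(x)}f'(x)\right)'$ with domain the differentiable functions $f$ on $[a,b]$ such that $f(a)=f(b)=0$ and $f'=e^{W}g$ with $g\in C^1$. A number $\lambda$ is called an eigenvalue of $L$ if there is $\phi\neq0$ in this domain with $L\phi+\lambda\phi=0$ (so $\phi(a)=\phi(b)=0$). The function $\psi(\cdot,\lambda)$ is equivalently the solution of $L\psi+\lambda\psi=0$ (with $L$ applied by its formula, without the boundary condition at $b$) with $\psi(a,\lambda)=0$, $\psi'(a,\lambda)=1$, where $'$ is the derivative in $x$. *)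

theory Defs
  imports "HOL-Analysis.Analysis"
begin

(* Functions on [a,b] are represented by total functions real => real of which only
   the values on {a..b} matter; hence derivatives are taken within {a..b}, i.e. they
   are one-sided at the two endpoints. *)
definition deriv_on :: "real \<Rightarrow> real \<Rightarrow> (real \<Rightarrow> real) \<Rightarrow> real \<Rightarrow> real" where
  "deriv_on a b f x = vector_derivative f (at x within {a..b})"

definition C1_on :: "real \<Rightarrow> real \<Rightarrow> (real \<Rightarrow> real) \<Rightarrow> bool" where
  "C1_on a b g \<longleftrightarrow> g differentiable_on {a..b} \<and> continuous_on {a..b} (deriv_on a b g)"

definition L_op :: "(real \<Rightarrow> real) \<Rightarrow> real \<Rightarrow> real \<Rightarrow> (real \<Rightarrow> real) \<Rightarrow> real \<Rightarrow> real" where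
  "L_op W a b f x =
     exp (W x) / 2 * deriv_on a b (\<lambda>y. exp (- W y) * deriv_on a b f y) x"

definition L_dom :: "(real \<Rightarrow> real) \<Rightarrow> real \<Rightarrow> real \<Rightarrow> (real \<Rightarrow> real) set" where
  "L_dom W a b = {f. f differentiable_on {a..b} \<and> f a = 0 \<and> f b = 0 \<and>
     (\<exists>g. C1_on a b g \<and> (\<forall>x\<in>{a..b}. deriv_on a b f x = exp (W x) * g x))}"

definition L_eigenvalue :: "(real \<Rightarrow> real) \<Rightarrow> real \<Rightarrow> real \<Rightarrow> real \<Rightarrow> bool" where
  "L_eigenvalue W a b lam \<longleftrightarrow>
     (\<exists>\<phi>\<in>L_dom W a b. (\<exists>x\<in>{a..b}. \<phi> x \<noteq> 0) \<and>
        (\<forall>x\<in>{a..b}. L_op W a b \<phi> x + lam * \<phi> x = 0))"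

(* The library integral of a non-integrable function is 0, so the existence of the inner
   integral is required explicitly. For continuous W the outer integrand is then
   continuous in y, and the outer integral exists as well. *)
definition psi_equation ::
  "(real \<Rightarrow> real) \<Rightarrow> real \<Rightarrow> real \<Rightarrow> real \<Rightarrow> (real \<Rightarrow> real) \<Rightarrow> bool" where
  "psi_equation W a b lam \<psi> \<longleftrightarrow>
     (\<lambda>z. \<psi> z * exp (- W z)) integrable_on {a..b} \<and>
     (\<forall>x\<in>{a..b}. \<psi> x =
        - 2 * lam * integral {a..x} (\<lambda>y. integral {a..y} (\<lambda>z. \<psi> z * exp (- W z) * exp (W y)))
        + 1 / exp (W a) * integral {a..x} (\<lambda>z. exp (W z)))"

end

theory Submission
  imports Defs
begin

text \<open>
  With \<open>v = e\<^sup>-\<^sup>W u'\<close>, the equation \<open>L u + \<lambda> u = 0\<close> becomes the linear first-order system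
  \<open>u' = e\<^sup>W v\<close>, \<open>v' = -2 \<lambda> e\<^sup>-\<^sup>W u\<close>, whose coefficients are continuous although \<open>W\<close>
  is not differentiable. An eigenfunction is exactly a solution of this system that vanishes at
  both endpoints but not everywhere (\<open>L_eigenvalue_iff_system\<close>), and the integral equation
  says that \<open>\<psi>\<close> is the first component of the solution that starts from
  \<open>(0, e\<^sup>-\<^sup>W\<^sup>(\<^sup>a\<^sup>))\<close> (\<open>psi_equation_imp_system\<close>).

  Hence if \<open>\<psi> b = 0\<close>, then \<open>\<psi>\<close> itself is an eigenfunction. Conversely, the coefficient
  matrix of the system has trace zero, so the Wronskian of an eigenfunction \<open>(\<phi>, g)\<close> and
  \<open>(\<psi>, p)\<close> is constant (\<open>wronskian_constant\<close>). It is zero at \<open>a\<close>, where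
  both functions vanish, so that at \<open>b\<close> it yields \<open>g b * \<psi> b = 0\<close>. Here
  \<open>g b\<close> cannot be zero: together with \<open>\<phi> b = 0\<close> this would force
  \<open>\<phi> = 0\<close> by uniqueness for linear systems (\<open>system_unique_zero\<close>).
\<close>

section \<open>Linear systems u' = r v, v' = s u on an interval\<close>

definition solves_system ::
  "real \<Rightarrow> real \<Rightarrow> (real \<Rightarrow> real) \<Rightarrow> (real \<Rightarrow> real) \<Rightarrow> (real \<Rightarrow> real) \<Rightarrow> (real \<Rightarrow> real) \<Rightarrow> bool" where
  "solves_system a b r s u v \<longleftrightarrow> (\<forall>x\<in>{a..b}.
     (u has_real_derivative r x * v x) (at x within {a..b}) \<and>
     (v has_real_derivative s x * u x) (at x within {a..b}))"

lemma solves_systemD: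
  assumes "solves_system a b r s u v" "x \<in> {a..b}"
  shows "(u has_real_derivative r x * v x) (at x within {a..b})"
    and "(v has_real_derivative s x * u x) (at x within {a..b})"
  using assms by (auto simp: solves_system_def)

text \<open>The four product-rule terms of \<open>(u1 v2 - v1 u2)'\<close> cancel in pairs, because the
  coefficient matrix has zero diagonal.\<close>

lemma wronskian_constant:
  assumes "solves_system a b r s u1 v1" "solves_system a b r s u2 v2"
    and "x \<in> {a..b}" "y \<in> {a..b}"
  shows "u1 x * v2 x - v1 x * u2 x = u1 y * v2 y - v1 y * u2 y"
proof -
  have "((\<lambda>x. u1 x * v2 x - v1 x * u2 x) has_real_derivative 0) (at x within {a..b})"
    if x: "x \<in> {a..b}" for x
    by (rule derivative_eq_intros solves_systemD[OF assms(1) x] solves_systemD[OF assms(2) x]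
        refl)+ (simp add: algebra_simps)
  then obtain c where "\<And>x. x \<in> {a..b} \<Longrightarrow> u1 x * v2 x - v1 x * u2 x = c"
    using has_field_derivative_zero_constant[of "{a..b}" "\<lambda>x. u1 x * v2 x - v1 x * u2 x"] by auto
  with assms(3,4) show ?thesis by simp
qed

text \<open>The energy \<open>E = u\<^sup>2 + v\<^sup>2\<close> satisfies \<open>E' = 2 (r + s) u v \<ge> - K E\<close> as soon as
  \<open>K\<close> bounds \<open>\<bar>r + s\<bar>\<close>. So \<open>E e\<^sup>K\<^sup>x\<close> is nondecreasing and, being
  nonnegative, vanishes everywhere to the left of a zero of \<open>E\<close>.\<close>

lemma system_unique_zero:
  assumes sol: "solves_system a b r s u v"
    and cont: "continuous_on {a..b} (\<lambda>x. r x + s x)"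
    and zero: "u b = 0" "v b = 0" and x: "x \<in> {a..b}"
  shows "u x = 0"
proof -
  have "bounded ((\<lambda>x. r x + s x) ` {a..b})"
    by (intro compact_imp_bounded compact_continuous_image cont compact_Icc)
  then obtain K where K: "\<And>y. y \<in> {a..b} \<Longrightarrow> \<bar>r y + s y\<bar> \<le> K"
    unfolding bounded_iff by (metis imageI real_norm_def)
  define F where "F y = ((u y)\<^sup>2 + (v y)\<^sup>2) * exp (K * y)" for y
  define F' where
    "F' y = ((r y + s y) * (2 * (u y * v y)) + K * ((u y)\<^sup>2 + (v y)\<^sup>2)) * exp (K * y)" for y
  have der: "(F has_real_derivative F' y) (at y within {a..b})" if y: "y \<in> {a..b}" for y
    unfolding F_def
    by (rule derivative_eq_intros solves_systemD[OF sol y] refl)+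
      (simp add: F'_def algebra_simps power2_eq_square)
  have nonneg: "F' y \<ge> 0" if y: "y \<in> {a..b}" for y
  proof -
    have "0 \<le> (\<bar>u y\<bar> - \<bar>v y\<bar>)\<^sup>2" by simp
    then have "2 * \<bar>u y * v y\<bar> \<le> (u y)\<^sup>2 + (v y)\<^sup>2"
      by (simp add: power2_diff abs_mult)
    then have "\<bar>r y + s y\<bar> * (2 * \<bar>u y * v y\<bar>) \<le> K * ((u y)\<^sup>2 + (v y)\<^sup>2)"
      using K[OF y] by (intro mult_mono) auto
    moreover have "\<bar>(r y + s y) * (2 * (u y * v y))\<bar> = \<bar>r y + s y\<bar> * (2 * \<bar>u y * v y\<bar>)"
      by (simp only: abs_mult abs_numeral)
    ultimately show ?thesis
      unfolding F'_def by (intro mult_nonneg_nonneg) (linarith, simp)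
  qed
  have "F x \<le> F b"
  proof (rule DERIV_nonneg_imp_increasing_open[of x b F])
    show "x \<le> b" using x by simp
    show "\<exists>D. (F has_real_derivative D) (at y) \<and> 0 \<le> D" if "x < y" "y < b" for y
      using der[of y] nonneg[of y] that x at_within_Icc_at[of a y b] by auto
    have "continuous_on {a..b} F"
      by (rule DERIV_continuous_on[OF der])
    then show "continuous_on {x..b} F"
      by (rule continuous_on_subset) (use x in auto)
  qed
  then have "(u x)\<^sup>2 + (v x)\<^sup>2 \<le> 0"
    using zero by (simp add: F_def mult_le_0_iff)
  then show ?thesis
    using zero_le_power2[of "v x"] by (smt (verit) power2_less_0 zero_less_power2)
qed

section \<open>The eigenvalue problem as a linear system\<close>

lemma deriv_on_eqI:
  assumes "a < b" "x \<in> {a..b}" "(f has_real_derivative D) (at x within {a..b})"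
  shows "deriv_on a b f x = D"
  using vector_derivative_within_cbox[of a b x f D] assms
  by (simp add: deriv_on_def has_real_derivative_iff_has_vector_derivative)

lemma deriv_on_works:
  assumes "f differentiable_on {a..b}" "x \<in> {a..b}"
  shows "(f has_real_derivative deriv_on a b f x) (at x within {a..b})"
  using assms
  by (auto simp: deriv_on_def differentiable_on_def vector_derivative_works
      has_real_derivative_iff_has_vector_derivative)

lemma differentiable_onI_real_derivative:
  assumes "\<And>x. x \<in> {a..b} \<Longrightarrow> (f has_real_derivative f' x) (at x within {a..b})"
  shows "f differentiable_on {a..b}"
  using assms unfolding differentiable_on_def
  by (blast intro: real_differentiable_def[THEN iffD2])

lemma deriv_on_cong:
  assumes "a < b" "x \<in> {a..b}" "g differentiable_on {a..b}" "\<And>y. y \<in> {a..b} \<Longrightarrow> f y = g y"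
  shows "deriv_on a b f x = deriv_on a b g x"
proof (rule deriv_on_eqI[OF assms(1,2)])
  show "(f has_real_derivative deriv_on a b g x) (at x within {a..b})"
    using deriv_on_works[OF assms(3,2)] assms(2)
    by (rule has_field_derivative_transform_within[OF _ zero_less_one]) (simp add: assms(4))
qed

lemma L_eigenvalue_iff_system:
  assumes ab: "a < b" and W: "continuous_on {a..b} W"
  shows "L_eigenvalue W a b lam \<longleftrightarrow>
    (\<exists>u v. solves_system a b (\<lambda>x. exp (W x)) (\<lambda>x. - 2 * lam * exp (- W x)) u v \<and>
       u a = 0 \<and> u b = 0 \<and> (\<exists>x\<in>{a..b}. u x \<noteq> 0))"
    (is "?E \<longleftrightarrow> (\<exists>u v. ?sys u v \<and> _ u)")
proof
  assume ?E
  then obtain u v where u: "u differentiable_on {a..b}" "u a = 0" "u b = 0"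
      "\<exists>x\<in>{a..b}. u x \<noteq> 0"
    and v: "v differentiable_on {a..b}"
    and uv: "\<And>x. x \<in> {a..b} \<Longrightarrow> deriv_on a b u x = exp (W x) * v x"
    and eq: "\<And>x. x \<in> {a..b} \<Longrightarrow> L_op W a b u x + lam * u x = 0"
    unfolding L_eigenvalue_def L_dom_def C1_on_def by blast
  have "deriv_on a b v x = - 2 * lam * exp (- W x) * u x" if x: "x \<in> {a..b}" for x
  proof -
    have "deriv_on a b (\<lambda>y. exp (- W y) * deriv_on a b u y) x = deriv_on a b v x"
      by (rule deriv_on_cong[OF ab x v]) (simp add: uv exp_minus)
    then show ?thesis
      using eq[OF x] by (simp add: L_op_def exp_minus field_simps)
  qed
  then have "?sys u v"
    using deriv_on_works[OF u(1)] deriv_on_works[OF v] uv by (simp add: solves_system_def)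
  with u show "\<exists>u v. ?sys u v \<and> u a = 0 \<and> u b = 0 \<and> (\<exists>x\<in>{a..b}. u x \<noteq> 0)" by blast
next
  assume "\<exists>u v. ?sys u v \<and> u a = 0 \<and> u b = 0 \<and> (\<exists>x\<in>{a..b}. u x \<noteq> 0)"
  then obtain u v where sys: "?sys u v" and u: "u a = 0" "u b = 0" "\<exists>x\<in>{a..b}. u x \<noteq> 0"
    by blast
  note der = solves_systemD[OF sys]
  have du: "u differentiable_on {a..b}"
    using der(1) by (rule differentiable_onI_real_derivative)
  have dv: "v differentiable_on {a..b}"
    using der(2) by (rule differentiable_onI_real_derivative)
  have uv: "deriv_on a b u x = exp (W x) * v x"
    and vu: "deriv_on a b v x = - 2 * lam * exp (- W x) * u x" if "x \<in> {a..b}" for x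
    using der[OF that] by (auto intro: deriv_on_eqI[OF ab that])
  have "continuous_on {a..b} (\<lambda>x. - 2 * lam * exp (- W x) * u x)"
    by (intro continuous_intros W differentiable_imp_continuous_on[OF du])
  then have "continuous_on {a..b} (deriv_on a b v)"
    by (rule continuous_on_eq) (simp only: vu)
  then have "C1_on a b v" using dv by (simp add: C1_on_def)
  then have "u \<in> L_dom W a b" using du u uv by (auto simp: L_dom_def)
  moreover have "L_op W a b u x + lam * u x = 0" if x: "x \<in> {a..b}" for x
  proof -
    have "deriv_on a b (\<lambda>y. exp (- W y) * deriv_on a b u y) x = deriv_on a b v x"
      by (rule deriv_on_cong[OF ab x dv]) (simp add: uv exp_minus)
    then show ?thesis
      using vu[OF x] by (simp add: L_op_def exp_minus)
  qed
  ultimately show ?E using u(3) by (auto simp: L_eigenvalue_def)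
qed

section \<open>The integral equation as an initial value problem\<close>

text \<open>The second component is \<open>p y = e\<^sup>-\<^sup>W\<^sup>(\<^sup>a\<^sup>) - 2 \<lambda> \<integral>\<^sub>a\<^sup>y \<psi> e\<^sup>-\<^sup>W\<close>, so that the integral
  equation reads \<open>\<psi> x = \<integral>\<^sub>a\<^sup>x e\<^sup>W p\<close>. Integrability alone makes \<open>p\<close>
  continuous, hence \<open>\<psi>\<close> is differentiable; this in turn makes the integrand
  \<open>\<psi> e\<^sup>-\<^sup>W\<close> of \<open>p\<close> continuous and \<open>p\<close> differentiable.\<close>

lemma psi_equation_imp_system:
  assumes "a < b" and W: "continuous_on {a..b} W" and psi: "psi_equation W a b lam \<psi>"
  obtains p where "solves_system a b (\<lambda>x. exp (W x)) (\<lambda>x. - 2 * lam * exp (- W x)) \<psi> p"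
    and "\<psi> a = 0" and "p a = exp (- W a)"
proof -
  define I where "I y = integral {a..y} (\<lambda>z. \<psi> z * exp (- W z))" for y
  define p where "p y = exp (- W a) - 2 * lam * I y" for y
  have int: "(\<lambda>z. \<psi> z * exp (- W z)) integrable_on {a..b}"
    and eq: "\<And>x. x \<in> {a..b} \<Longrightarrow> \<psi> x =
        - 2 * lam * integral {a..x} (\<lambda>y. integral {a..y} (\<lambda>z. \<psi> z * exp (- W z) * exp (W y)))
        + 1 / exp (W a) * integral {a..x} (\<lambda>z. exp (W z))"
    using psi by (auto simp: psi_equation_def)
  have contI: "continuous_on {a..b} I"
    unfolding I_def by (rule indefinite_integral_continuous_1[OF int])
  have contp: "continuous_on {a..b} (\<lambda>y. exp (W y) * p y)"
    unfolding p_def by (intro continuous_intros W contI)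
  have \<psi>_eq: "\<psi> x = integral {a..x} (\<lambda>y. exp (W y) * p y)" if x: "x \<in> {a..b}" for x
  proof -
    have sub: "{a..x} \<subseteq> {a..b}" using x by auto
    have i1: "(\<lambda>y. I y * exp (W y)) integrable_on {a..x}"
      and i2: "(\<lambda>y. exp (W y)) integrable_on {a..x}"
      by (intro integrable_continuous_real continuous_intros
          continuous_on_subset[OF contI sub] continuous_on_subset[OF W sub])+
    have "integral {a..x} (\<lambda>y. exp (W y) * p y)
        = integral {a..x} (\<lambda>y. - 2 * lam * (I y * exp (W y)) + exp (- W a) * exp (W y))"
      by (simp add: p_def algebra_simps)
    also have "\<dots> = integral {a..x} (\<lambda>y. - 2 * lam * (I y * exp (W y)))
        + integral {a..x} (\<lambda>y. exp (- W a) * exp (W y))"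
      by (intro Henstock_Kurzweil_Integration.integral_add integrable_on_mult_right i1 i2)
    also have "\<dots> = - 2 * lam * integral {a..x} (\<lambda>y. I y * exp (W y))
        + exp (- W a) * integral {a..x} (\<lambda>y. exp (W y))"
      by simp
    also have "\<dots> = \<psi> x"
      unfolding eq[OF x] I_def by (simp add: exp_minus[of "W a"] divide_inverse)
    finally show ?thesis by simp
  qed
  have der\<psi>: "(\<psi> has_real_derivative exp (W x) * p x) (at x within {a..b})"
    if x: "x \<in> {a..b}" for x
  proof -
    have "((\<lambda>x. integral {a..x} (\<lambda>y. exp (W y) * p y)) has_real_derivative exp (W x) * p x)
        (at x within {a..b})"
      by (rule integral_has_real_derivative[OF contp x])
    then show ?thesis
      by (rule has_field_derivative_transform_within[OF _ zero_less_one x]) (simp add: \<psi>_eq)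
  qed
  have cont\<psi>: "continuous_on {a..b} (\<lambda>z. \<psi> z * exp (- W z))"
    by (intro continuous_intros W DERIV_continuous_on[OF der\<psi>])
  have "(p has_real_derivative - 2 * lam * exp (- W x) * \<psi> x) (at x within {a..b})"
    if x: "x \<in> {a..b}" for x
    unfolding p_def I_def
    by (rule derivative_eq_intros integral_has_real_derivative[OF cont\<psi> x] refl)+ simp
  with der\<psi> have "solves_system a b (\<lambda>x. exp (W x)) (\<lambda>x. - 2 * lam * exp (- W x)) \<psi> p"
    by (simp add: solves_system_def)
  moreover have "\<psi> a = 0" using \<psi>_eq[of a] \<open>a < b\<close> by simp
  moreover have "p a = exp (- W a)" by (simp add: p_def I_def)
  ultimately show ?thesis by (rule that)
qed

section \<open>The characterization of the eigenvalues\<close>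

theorem theorem15:
  fixes W :: "real \<Rightarrow> real" and a b lam :: real and \<psi> :: "real \<Rightarrow> real"
  assumes "a < b"
    and "continuous_on UNIV W"
    and "psi_equation W a b lam \<psi>"
  shows "L_eigenvalue W a b lam \<longleftrightarrow> \<psi> b = 0"
proof -
  let ?sys = "solves_system a b (\<lambda>x. exp (W x)) (\<lambda>x. - 2 * lam * exp (- W x))"
  have W: "continuous_on {a..b} W"
    using assms(2) by (rule continuous_on_subset) simp
  have a: "a \<in> {a..b}" and b: "b \<in> {a..b}" using assms(1) by auto
  obtain p where \<psi>: "?sys \<psi> p" and \<psi>a: "\<psi> a = 0" and pa: "p a = exp (- W a)"
    using psi_equation_imp_system[OF assms(1) W assms(3)] by blast
  show ?thesis
    unfolding L_eigenvalue_iff_system[OF assms(1) W]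
  proof
    assume "\<exists>u v. ?sys u v \<and> u a = 0 \<and> u b = 0 \<and> (\<exists>x\<in>{a..b}. u x \<noteq> 0)"
    then obtain \<phi> g where \<phi>: "?sys \<phi> g" "\<phi> a = 0" "\<phi> b = 0" "\<exists>x\<in>{a..b}. \<phi> x \<noteq> 0"
      by blast
    have "g b * \<psi> b = 0"
      using wronskian_constant[OF \<phi>(1) \<psi> a b] \<phi>(2,3) \<psi>a by simp
    moreover have "g b \<noteq> 0"
    proof
      assume "g b = 0"
      moreover have "continuous_on {a..b} (\<lambda>x. exp (W x) + - 2 * lam * exp (- W x))"
        by (intro continuous_intros W)
      ultimately show False
        using system_unique_zero[OF \<phi>(1) _ \<phi>(3)] \<phi>(4) by blast
    qed
    ultimately show "\<psi> b = 0" by simp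
  next
    assume "\<psi> b = 0"
    moreover have "\<exists>x\<in>{a..b}. \<psi> x \<noteq> 0"
    proof (rule ccontr)
      assume "\<not> (\<exists>x\<in>{a..b}. \<psi> x \<noteq> 0)"
      then have z: "\<psi> x = 0" if "x \<in> {a..b}" for x using that by blast
      \<comment> \<open>But the initial values give \<open>\<psi>\<close> slope 1 at \<open>a\<close>.\<close>
      have "((\<lambda>_. 0) has_real_derivative exp (W a) * p a) (at a within {a..b})"
        using solves_systemD(1)[OF \<psi> a]
        by (rule has_field_derivative_transform_within[OF _ zero_less_one a]) (simp add: z)
      moreover have "((\<lambda>_. 0) has_real_derivative 0) (at a within {a..b})" by simp
      ultimately have "exp (W a) * p a = 0"
        using deriv_on_eqI[OF assms(1) a] by metis
      then show False by (simp add: pa)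
    qed
    ultimately show "\<exists>u v. ?sys u v \<and> u a = 0 \<and> u b = 0 \<and> (\<exists>x\<in>{a..b}. u x \<noteq> 0)"
      using \<psi> \<psi>a by blast
  qed
qed

end
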